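(* Let $p_{m,n}$ be the number of Ferrers diagrams of half-perimeter $m$ and area $n$, and let $\widetilde X_m$ ($m\ge2$) be the random variable with $\mathbb P(\widetilde X_m=n)=p_{m,n}/\sum_np_{m,n}$. Then $\widetilde X_m$ has mean $\mu_m\sim m^2/8$ as $m\to\infty$, and the normalised random variables $X_m=\widetilde X_m/m^2$ converge in distribution to a random variable with density $p(x)=\delta(x-1/8)$, i.e. to the constant $1/8$.
   Context: A Ferrers diagram is the diagram of an integer partition $\lambda_1\ge\lambda_2\ge\dots\ge\lambda_r\ge1$ with $r\ge1$, viewed as a square lattice polygon made of left-aligned rows of $\lambda_i$ unit cells. Its area is $\sum_i\lambda_i$ and its half-perimeter is $\lambda_1+r$. The generating function $P(x,q)=\sum_{m,n}p_{m,n}x^mq^n$ satisfies $P(x,q)=\frac{qx^2}{(1-qx)^2}P(qx,q)+\frac{qx^2}{(1-qx)^2}$ up to the form in which diagrams are decomposed, and $P(x,1)=x^2/(1-2x)$. For sequences, $a_m\sim b_m$ means $a_m/b_m\to1$. *)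

theory Defs
  imports "HOL-Probability.Probability" "HOL-Library.Landau_Symbols"
begin

definition is_partition :: "nat list \<Rightarrow> bool" where
  "is_partition xs \<longleftrightarrow> xs \<noteq> [] \<and> sorted_wrt (\<ge>) xs \<and> (\<forall>x\<in>set xs. 1 \<le> x)"

text \<open>A lattice polygon is represented by the set of its unit cells (row, column); fixing the
  corner at (0, 0) picks one representative from each class of translates.\<close>

definition diagram :: "nat list \<Rightarrow> (nat \<times> nat) set" where
  "diagram xs = {(i, j). i < length xs \<and> j < xs ! i}"

definition area :: "nat list \<Rightarrow> nat" where
  "area xs = sum_list xs"

definition half_perimeter :: "nat list \<Rightarrow> nat" where
  "half_perimeter xs = hd xs + length xs"

definition ferrers :: "nat \<Rightarrow> nat \<Rightarrow> (nat \<times> nat) set set" where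
  "ferrers m n = diagram ` {xs. is_partition xs \<and> half_perimeter xs = m \<and> area xs = n}"

definition num_ferrers :: "nat \<Rightarrow> nat \<Rightarrow> nat" where
  "num_ferrers m n = card (ferrers m n)"

text \<open>The next lemmas confirm that a diagram determines its partition, that \<open>num_ferrers\<close> counts finite
  sets, and that the normalising sum over \<open>n\<close> has finite support and is positive for
  \<open>m \<ge> 2\<close>.\<close>

lemma inj_on_diagram: "inj_on diagram (Collect is_partition)"
proof (rule inj_onI)
  fix xs ys
  assume "xs \<in> Collect is_partition" "ys \<in> Collect is_partition" and eq: "diagram xs = diagram ys"
  then have pos: "\<And>i. i < length xs \<Longrightarrow> 0 < xs ! i" "\<And>i. i < length ys \<Longrightarrow> 0 < ys ! i"
    by (auto simp: is_partition_def Suc_le_eq)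
  have iff: "(i < length xs \<and> j < xs ! i) \<longleftrightarrow> (i < length ys \<and> j < ys ! i)" for i j
    using eq unfolding diagram_def set_eq_iff by auto
  have "i < length xs \<longleftrightarrow> i < length ys" for i
    using iff[of i 0] pos[of i] by (metis gr0I less_irrefl)
  then have len: "length xs = length ys"
    by (metis nat_neq_iff)
  show "xs = ys"
  proof (rule nth_equalityI[OF len])
    fix i assume "i < length xs"
    then have "j < xs ! i \<longleftrightarrow> j < ys ! i" for j
      using iff[of i j] len by auto
    then show "xs ! i = ys ! i"
      by (metis nat_neq_iff)
  qed
qed

lemma partition_le_hd: "is_partition xs \<Longrightarrow> x \<in> set xs \<Longrightarrow> x \<le> hd xs"
  by (cases xs) (auto simp: is_partition_def)

lemma finite_partitions: "finite {xs. is_partition xs \<and> half_perimeter xs = m}"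
proof (rule finite_subset)
  show "{xs. is_partition xs \<and> half_perimeter xs = m} \<subseteq> {xs. set xs \<subseteq> {..m} \<and> length xs \<le> m}"
    by (force simp: half_perimeter_def dest: partition_le_hd)
  show "finite {xs. set xs \<subseteq> {..m} \<and> length xs \<le> m}"
    by (rule finite_lists_length_le) simp
qed

lemma finite_ferrers: "finite (ferrers m n)"
  unfolding ferrers_def
  by (rule finite_imageI, rule finite_subset[OF _ finite_partitions[of m]]) auto

lemma finite_support: "finite {n. num_ferrers m n \<noteq> 0}"
proof (rule finite_subset)
  show "{n. num_ferrers m n \<noteq> 0} \<subseteq> area ` {xs. is_partition xs \<and> half_perimeter xs = m}"
  proof
    fix n assume "n \<in> {n. num_ferrers m n \<noteq> 0}"
    then have "ferrers m n \<noteq> {}"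
      by (auto simp: num_ferrers_def)
    then show "n \<in> area ` {xs. is_partition xs \<and> half_perimeter xs = m}"
      by (auto simp: ferrers_def)
  qed
  show "finite (area ` {xs. is_partition xs \<and> half_perimeter xs = m})"
    by (intro finite_imageI finite_partitions)
qed

lemma summable_num_ferrers: "summable (\<lambda>n. real (num_ferrers m n))"
  by (rule summable_finite[OF finite_support[of m]]) auto

lemma suminf_num_ferrers_pos:
  assumes "2 \<le> m"
  shows "0 < (\<Sum>n. real (num_ferrers m n))"
proof -
  have "diagram [m - 1] \<in> ferrers m (m - 1)"
    unfolding ferrers_def using assms
    by (intro imageI) (auto simp: is_partition_def half_perimeter_def area_def)
  then have "0 < real (num_ferrers m (m - 1))"
    using finite_ferrers by (auto simp: num_ferrers_def card_gt_0_iff)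
  then show ?thesis
    by (intro suminf_pos2[OF summable_num_ferrers, where i = "m - 1"]) auto
qed

end

theory Submission
  imports Defs "HOL-Real_Asymp.Real_Asymp"
begin

text \<open>Every partition other than (1) arises in exactly one way by either appending a row of length
  one or adding a new first column. A step of the first kind changes (length, area) from (r, a) to
  (r + 1, a + 1), one of the second kind to (r, a + r), so the averages of r, a and of their
  pairwise products over the partitions of half-perimeter m obey linear recurrences with polynomial
  solutions in m. The mean area is (m^2 + 3 m - 2) / 8, and the mean square of
  area - m^2 / 8 is only of order m^3; hence area / m^2 tends to 1/8 in mean square and
  therefore in distribution.\<close>

section \<open>Recursive structure of the partitions of fixed half-perimeter\<close>

definition partitions :: "nat \<Rightarrow> nat list set" where
  "partitions m = {xs. is_partition xs \<and> half_perimeter xs = m}"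

lemma finite_partitions_set [simp]: "finite (partitions m)"
  unfolding partitions_def by (rule finite_partitions)

lemma partitions_2: "partitions 2 = {[1]}"
proof -
  have "xs = [1]" if h: "is_partition xs" "half_perimeter xs = 2" for xs
  proof -
    obtain x ys where xs: "xs = x # ys" using h by (cases xs) (auto simp: is_partition_def)
    with h have "x \<ge> 1" "x + length ys = 1"
      by (auto simp: is_partition_def half_perimeter_def)
    then have "x = 1" "ys = []" by (cases ys; simp)+
    then show ?thesis using xs by simp
  qed
  then show ?thesis
    by (auto simp: partitions_def is_partition_def half_perimeter_def)
qed

lemma partitions_nonempty:
  assumes "2 \<le> m"
  shows "partitions m \<noteq> {}"
proof -
  have "[m - 1] \<in> partitions m"
    using assms by (auto simp: partitions_def is_partition_def half_perimeter_def)
  then show ?thesis by blast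
qed

text \<open>Look at the last, hence smallest, row. If it is 1, delete it; otherwise every row has at
  least two cells and the first column can be deleted. Either way the half-perimeter drops by
  one.\<close>

lemma partitions_Suc:
  assumes "2 \<le> m"
  shows "partitions (Suc m) = (\<lambda>xs. xs @ [1]) ` partitions m \<union> map Suc ` partitions m"
proof
  show "(\<lambda>xs. xs @ [1]) ` partitions m \<union> map Suc ` partitions m \<subseteq> partitions (Suc m)"
    by (auto simp: partitions_def is_partition_def half_perimeter_def sorted_wrt_append
        sorted_wrt_map hd_map)
  show "partitions (Suc m) \<subseteq> (\<lambda>xs. xs @ [1]) ` partitions m \<union> map Suc ` partitions m"
  proof
    fix xs assume xs: "xs \<in> partitions (Suc m)"
    then have "xs \<noteq> []" by (auto simp: partitions_def is_partition_def)
    then obtain ys y where ys: "xs = ys @ [y]" by (metis rev_exhaust)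
    have part: "sorted_wrt (\<ge>) ys" "\<forall>x\<in>set ys. y \<le> x" "1 \<le> y" "hd xs + length xs = Suc m"
      using xs by (auto simp: ys partitions_def is_partition_def half_perimeter_def sorted_wrt_append)
    show "xs \<in> (\<lambda>xs. xs @ [1]) ` partitions m \<union> map Suc ` partitions m"
    proof (cases "y = 1")
      case True
      \<comment> \<open>The bound on \<open>m\<close> enters here: \<open>[1]\<close> has
        half-perimeter 2, but \<open>Suc m\<close> is at least 3, so a row remains after deleting
        the last one.\<close>
      then have "ys \<noteq> []" using part assms ys by auto
      then have "ys \<in> partitions m"
        using part True ys by (auto simp: partitions_def is_partition_def half_perimeter_def)
      then show ?thesis using ys True by auto
    next
      case False
      let ?zs = "map (\<lambda>x. x - 1) xs"
      \<comment> \<open>The last row is minimal, so no row equals 1: subtracting 1 is undone by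
        \<open>Suc\<close> and leaves positive rows.\<close>
      have ge: "2 \<le> x" if "x \<in> set xs" for x using that part False ys by force
      then have "xs = map Suc ?zs" by (subst map_map, subst map_idI) (auto simp: Suc_le_eq dest: ge)
      moreover have "?zs \<in> partitions m"
      proof -
        have "sorted_wrt (\<ge>) xs" "xs \<noteq> []" using part ys by (auto simp: sorted_wrt_append)
        moreover from \<open>xs \<noteq> []\<close> have "2 \<le> hd xs" by (intro ge hd_in_set)
        moreover have "hd xs - 1 + length xs = m" using part(4) \<open>2 \<le> hd xs\<close> by linarith
        moreover have "sorted_wrt (\<ge>) ?zs"
          unfolding sorted_wrt_map by (rule sorted_wrt_mono_rel[OF _ \<open>sorted_wrt (\<ge>) xs\<close>]) auto
        moreover have "1 \<le> x - 1" if "x \<in> set xs" for x using ge[OF that] by simp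
        ultimately show ?thesis
          unfolding partitions_def is_partition_def half_perimeter_def by (simp add: hd_map)
      qed
      ultimately show ?thesis by blast
    qed
  qed
qed

text \<open>Both constructions are injective, and their images are disjoint because an entry 1
  occurs in every list of the first kind and in none of the second. The two summands are the values
  of \<open>f\<close> after adding a row and after adding a column.\<close>

lemma sum_partitions_Suc:
  fixes f :: "real \<Rightarrow> real \<Rightarrow> real"
  assumes "2 \<le> m"
  shows "(\<Sum>xs\<in>partitions (Suc m). f (length xs) (area xs)) =
    (\<Sum>xs\<in>partitions m. f (length xs + 1) (area xs + 1) + f (length xs) (area xs + length xs))"
proof -
  have disj: "(\<lambda>xs. xs @ [1]) ` partitions m \<inter> map Suc ` partitions m = {}"
  proof (rule ccontr)
    assume "\<not> ?thesis"
    then obtain xs ys where "ys \<in> partitions m" and eq: "xs @ [1] = map Suc ys" by blast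
    moreover have "1 \<in> set (map Suc ys)" unfolding eq[symmetric] by simp
    ultimately show False by (auto simp: partitions_def is_partition_def)
  qed
  have area: "sum_list (map Suc xs) = sum_list xs + length xs" for xs by (induction xs) auto
  have "inj_on (\<lambda>xs. xs @ [1]) (partitions m)" "inj_on (map Suc) (partitions m)"
    by (auto intro: inj_onI)
  then show ?thesis
    unfolding partitions_Suc[OF assms]
    by (subst sum.union_disjoint)
       (use disj in \<open>auto simp: sum.reindex sum.distrib area_def area add_ac\<close>)
qed

text \<open>The recurrence for constant \<open>f\<close> is a doubling, starting from one partition
  at half-perimeter 2. These are the coefficients of x^2 / (1 - 2 x).\<close>

lemma card_partitions: "2 \<le> m \<Longrightarrow> card (partitions m) = 2 ^ (m - 2)"
proof (induction m rule: dec_induct)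
  case base
  show ?case by (simp add: partitions_2)
next
  case (step m)
  have "real (card (partitions (Suc m))) = 2 ^ (Suc m - 2)"
    using sum_partitions_Suc[of m "\<lambda>r a. 1"] step by (simp add: Suc_diff_le del: diff_Suc_Suc diff_Suc_numeral)
  then show ?case by (metis of_nat_eq_iff of_nat_numeral of_nat_power)
qed

section \<open>Moments of length and area under the uniform distribution\<close>

definition mean_partitions :: "nat \<Rightarrow> (real \<Rightarrow> real \<Rightarrow> real) \<Rightarrow> real" where
  "mean_partitions m f = (\<Sum>xs\<in>partitions m. f (length xs) (area xs)) / card (partitions m)"

lemma mean_partitions_2: "mean_partitions 2 f = f 1 1"
  by (simp add: mean_partitions_def partitions_2 area_def)

text \<open>Since the number of partitions doubles, a uniform partition of half-perimeter
  \<open>Suc m\<close> arises from a uniform one of half-perimeter \<open>m\<close> by a fair choice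
  between row and column.\<close>

lemma mean_partitions_Suc:
  assumes "2 \<le> m"
  shows "mean_partitions (Suc m) f =
    mean_partitions m (\<lambda>r a. f (r + 1) (a + 1) + f r (a + r)) / 2"
  using assms
  by (simp add: mean_partitions_def card_partitions Suc_diff_le
      sum_partitions_Suc[where f = f] mult.commute add.commute[of 1]
      del: diff_Suc_Suc diff_Suc_numeral)

lemma mean_partitions_add:
  "mean_partitions m (\<lambda>r a. f r a + g r a) = mean_partitions m f + mean_partitions m g"
  by (simp add: mean_partitions_def sum.distrib add_divide_distrib)

lemma mean_partitions_cmult:
  "mean_partitions m (\<lambda>r a. c * f r a) = c * mean_partitions m f"
  by (simp add: mean_partitions_def sum_distrib_left)

lemma mean_partitions_const:
  "2 \<le> m \<Longrightarrow> mean_partitions m (\<lambda>r a. c) = c"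
  by (simp add: mean_partitions_def card_gt_0_iff partitions_nonempty)

text \<open>The pattern for all moments below: the moment itself reappears with factor 2, which the
  halving cancels, so its increment involves only moments already computed. Here the increment is
  1/2.\<close>

lemma mean_length: "2 \<le> m \<Longrightarrow> mean_partitions m (\<lambda>r a. r) = m / 2"
proof (induction m rule: dec_induct)
  case base
  show ?case by (simp add: mean_partitions_2)
next
  case (step m)
  have "mean_partitions (Suc m) (\<lambda>r a. r) = mean_partitions m (\<lambda>r a. 2 * r + 1) / 2"
    using step by (simp add: mean_partitions_Suc algebra_simps)
  also have "\<dots> = (2 * mean_partitions m (\<lambda>r a. r)
      + 1) / 2"
    using step.hyps by (simp only: mean_partitions_add mean_partitions_cmult mean_partitions_const)
  finally show ?case
    by (simp only: step.IH step.hyps)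
      (simp add: field_simps)
qed

text \<open>Equivalently, the variance is (m - 2) / 4: the length is 1 plus a binomial variable with
  m - 2 fair trials.\<close>

lemma mean_length_square:
  "2 \<le> m \<Longrightarrow> mean_partitions m (\<lambda>r a. r\<^sup>2) = (real m ^ 2 + m - 2) / 4"
proof (induction m rule: dec_induct)
  case base
  show ?case by (simp add: mean_partitions_2)
next
  case (step m)
  have "mean_partitions (Suc m) (\<lambda>r a. r\<^sup>2) = mean_partitions m (\<lambda>r a. 2 * r\<^sup>2 + 2 * r + 1) / 2"
    using step by (simp add: mean_partitions_Suc algebra_simps power2_eq_square)
  also have "\<dots> = (2 * mean_partitions m (\<lambda>r a. r\<^sup>2)
      + 2 * mean_partitions m (\<lambda>r a. r)
      + 1) / 2"
    using step.hyps by (simp only: mean_partitions_add mean_partitions_cmult mean_partitions_const)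
  finally show ?case
    by (simp only: step.IH mean_length step.hyps)
      (simp add: field_simps power2_eq_square)
qed

text \<open>The increment is half the mean of r + 1, that is m / 4 + 1 / 2, which sums to the
  leading term m^2 / 8.\<close>

lemma mean_area:
  "2 \<le> m \<Longrightarrow> mean_partitions m (\<lambda>r a. a) = (real m ^ 2 + 3 * m - 2) / 8"
proof (induction m rule: dec_induct)
  case base
  show ?case by (simp add: mean_partitions_2)
next
  case (step m)
  have "mean_partitions (Suc m) (\<lambda>r a. a) = mean_partitions m (\<lambda>r a. 2 * a + r + 1) / 2"
    using step by (simp add: mean_partitions_Suc algebra_simps)
  also have "\<dots> = (2 * mean_partitions m (\<lambda>r a. a)
      + mean_partitions m (\<lambda>r a. r)
      + 1) / 2"
    using step.hyps by (simp only: mean_partitions_add mean_partitions_cmult mean_partitions_const)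
  finally show ?case
    by (simp only: step.IH mean_length step.hyps)
      (simp add: field_simps power2_eq_square)
qed

text \<open>This mixed moment is needed for the second moment of the area, because a new column
  turns a^2 into (a + r)^2.\<close>

lemma mean_length_area:
  "2 \<le> m \<Longrightarrow> mean_partitions m (\<lambda>r a. r * a) = (real m ^ 3 + 3 * real m ^ 2 - 2 * m) / 16"
proof (induction m rule: dec_induct)
  case base
  show ?case by (simp add: mean_partitions_2)
next
  case (step m)
  have "mean_partitions (Suc m) (\<lambda>r a. r * a) =
      mean_partitions m (\<lambda>r a. 2 * (r * a) + r\<^sup>2 + r + a + 1) / 2"
    using step by (simp add: mean_partitions_Suc algebra_simps power2_eq_square)
  also have "\<dots> = (2 * mean_partitions m (\<lambda>r a. r * a)
      + mean_partitions m (\<lambda>r a. r\<^sup>2)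
      + mean_partitions m (\<lambda>r a. r)
      + mean_partitions m (\<lambda>r a. a)
      + 1) / 2"
    using step.hyps by (simp only: mean_partitions_add mean_partitions_cmult mean_partitions_const)
  finally show ?case
    by (simp only: step.IH mean_length mean_length_square mean_area step.hyps)
      (simp add: field_simps power2_eq_square power3_eq_cube)
qed

text \<open>The leading coefficient 3 / 192 is the square of 1 / 8, so the area concentrates around
  its mean.\<close>

lemma mean_area_square:
  "2 \<le> m \<Longrightarrow> mean_partitions m (\<lambda>r a. a\<^sup>2) =
    (3 * real m ^ 4 + 22 * real m ^ 3 - 3 * real m ^ 2 - 22 * m + 24) / 192"
proof (induction m rule: dec_induct)
  case base
  show ?case by (simp add: mean_partitions_2)
next
  case (step m)
  have "mean_partitions (Suc m) (\<lambda>r a. a\<^sup>2) =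
      mean_partitions m (\<lambda>r a. 2 * a\<^sup>2 + 2 * (r * a) + 2 * a + r\<^sup>2 + 1) / 2"
    using step by (simp add: mean_partitions_Suc algebra_simps power2_eq_square)
  also have "\<dots> = (2 * mean_partitions m (\<lambda>r a. a\<^sup>2)
      + 2 * mean_partitions m (\<lambda>r a. r * a)
      + 2 * mean_partitions m (\<lambda>r a. a)
      + mean_partitions m (\<lambda>r a. r\<^sup>2)
      + 1) / 2"
    using step.hyps by (simp only: mean_partitions_add mean_partitions_cmult mean_partitions_const)
  finally show ?case
    by (simp only: step.IH mean_length_area mean_length_square mean_area step.hyps)
      (simp add: field_simps power2_eq_square power3_eq_cube power4_eq_xxxx)
qed

text \<open>Centring at the limit 1 / 8 instead of the exact mean treats variance and bias together.
  The leading terms cancel, 1/64 - 1/32 + 1/64 = 0, and a quantity of order 1 / m remains.\<close>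

lemma mean_area_deviation:
  assumes "2 \<le> m"
  shows "mean_partitions m (\<lambda>r a. (a / (real m)\<^sup>2 - 1 / 8)\<^sup>2) =
    (4 * real m ^ 3 + 9 * real m ^ 2 - 22 * m + 24) / (192 * real m ^ 4)"
proof -
  \<comment> \<open>The square is expanded into a sum of scalar multiples, with the minus sign
    inside the coefficient, so that linearity of the mean applies termwise.\<close>
  have eq: "(\<lambda>r a. (a / (real m)\<^sup>2 - 1 / 8)\<^sup>2) =
      (\<lambda>r a. 1 / real m ^ 4 * a\<^sup>2 + (- (1 / (4 * (real m)\<^sup>2))) * a + 1 / 64)"
    using assms by (intro ext) (simp add: power2_eq_square power4_eq_xxxx field_simps)
  have "mean_partitions m (\<lambda>r a. (a / (real m)\<^sup>2 - 1 / 8)\<^sup>2) =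
     1 / real m ^ 4 * mean_partitions m (\<lambda>r a. a\<^sup>2)
     + (- (1 / (4 * (real m)\<^sup>2))) * mean_partitions m (\<lambda>r a. a) + 1 / 64"
    by (subst eq) (simp only: mean_partitions_add mean_partitions_cmult mean_partitions_const[OF assms])
  also have "\<dots> = (4 * real m ^ 3 + 9 * real m ^ 2 - 22 * m + 24) / (192 * real m ^ 4)"
    using assms unfolding mean_area[OF assms] mean_area_square[OF assms]
    by (simp add: power2_eq_square power3_eq_cube power4_eq_xxxx field_simps)
  finally show ?thesis .
qed

section \<open>The law of the area, from diagram counts to uniform partitions\<close>

lemma num_ferrers_eq_card: "num_ferrers m n = card {xs \<in> partitions m. area xs = n}"
proof -
  have "inj_on diagram {xs. is_partition xs \<and> half_perimeter xs = m \<and> area xs = n}"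
    by (rule inj_on_subset[OF inj_on_diagram]) auto
  then show ?thesis
    by (simp add: num_ferrers_def ferrers_def card_image partitions_def conj_assoc)
qed

text \<open>Sort the finitely many partitions by area; values of \<open>n\<close> that no area
  attains contribute 0.\<close>

lemma suminf_num_ferrers: "(\<Sum>n. real (num_ferrers m n)) = card (partitions m)"
proof -
  have "(\<Sum>n. real (num_ferrers m n)) = (\<Sum>n\<in>area ` partitions m. real (num_ferrers m n))"
  proof (rule suminf_finite)
    fix n assume "n \<notin> area ` partitions m"
    then have "{xs \<in> partitions m. area xs = n} = {}" by auto
    then show "real (num_ferrers m n) = 0" by (simp only: num_ferrers_eq_card) simp
  qed simp
  also have "\<dots> = card (partitions m)"
    using sum.image_gen[of "partitions m" "\<lambda>_. 1::nat" area]
    by (simp add: num_ferrers_eq_card flip: of_nat_sum)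
  finally show ?thesis .
qed

text \<open>This identifies the prescribed law as the image of the uniform distribution on
  \<open>partitions m\<close> under \<open>area\<close>.\<close>

lemma pmf_area:
  assumes "2 \<le> m"
  shows "pmf (map_pmf area (pmf_of_set (partitions m))) n =
    real (num_ferrers m n) / (\<Sum>k. real (num_ferrers m k))"
  using partitions_nonempty[OF assms] unfolding suminf_num_ferrers
  by (simp add: pmf_map measure_pmf_of_set num_ferrers_eq_card vimage_def Int_def)

text \<open>A measure on a countable discrete space is determined by its point masses, so the law
  does not depend on the underlying space \<open>M\<close>.\<close>

lemma distr_area:
  assumes "2 \<le> m" "prob_space M" and X: "X \<in> measurable M (count_space UNIV)"
    and law: "\<And>n. measure M {\<omega> \<in> space M. X \<omega> = n} =
      real (num_ferrers m n) / (\<Sum>k. real (num_ferrers m k))"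
  shows "distr M (count_space UNIV) X = map_pmf area (pmf_of_set (partitions m))"
proof (rule measure_eqI_countable[of _ UNIV])
  fix n :: nat
  interpret prob_space M by fact
  have "emeasure (distr M (count_space UNIV) X) {n} = ennreal (measure M {\<omega> \<in> space M. X \<omega> = n})"
    using X by (simp add: emeasure_distr emeasure_eq_measure vimage_def Int_def conj_commute)
  then show "emeasure (distr M (count_space UNIV) X) {n} =
      emeasure (measure_pmf (map_pmf area (pmf_of_set (partitions m)))) {n}"
    by (simp only: emeasure_pmf_single pmf_area[OF assms(1)] law)
qed auto

text \<open>The law has finite support, so every \<open>g\<close> is integrable and its expectation
  is a finite average; this carries the moments over to an arbitrary \<open>M\<close>.\<close>

lemma expectation_area:
  fixes g :: "nat \<Rightarrow> real"
  assumes "2 \<le> m" "prob_space M" and X: "X \<in> measurable M (count_space UNIV)"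
    and law: "\<And>n. measure M {\<omega> \<in> space M. X \<omega> = n} =
      real (num_ferrers m n) / (\<Sum>k. real (num_ferrers m k))"
  shows "integrable M (\<lambda>\<omega>. g (X \<omega>))"
    and "integral\<^sup>L M (\<lambda>\<omega>. g (X \<omega>)) = (\<Sum>xs\<in>partitions m. g (area xs)) / card (partitions m)"
proof -
  let ?p = "map_pmf area (pmf_of_set (partitions m))"
  have ne: "partitions m \<noteq> {}" by (rule partitions_nonempty) fact
  have "integrable (measure_pmf ?p) g"
    by (rule integrable_measure_pmf_finite) (simp add: set_pmf_of_set ne)
  then have "integrable (distr M (count_space UNIV) X) g"
    unfolding distr_area[OF assms] .
  then show "integrable M (\<lambda>\<omega>. g (X \<omega>))"
    using X by (subst (asm) integrable_distr_eq) auto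
  have "integral\<^sup>L M (\<lambda>\<omega>. g (X \<omega>)) = integral\<^sup>L (distr M (count_space UNIV) X) g"
    using X by (subst integral_distr) auto
  also have "\<dots> = (\<Sum>xs\<in>partitions m. g (area xs)) / card (partitions m)"
    unfolding distr_area[OF assms] by (simp add: integral_pmf_of_set ne)
  finally show "integral\<^sup>L M (\<lambda>\<omega>. g (X \<omega>)) = (\<Sum>xs\<in>partitions m. g (area xs)) / card (partitions m)" .
qed

section \<open>Mean-square convergence to a constant implies weak convergence\<close>

text \<open>Chebyshev's argument: at a point x other than c, the distribution function differs from
  the unit step at c by at most the probability of a deviation of at least |x - c|. The hypotheses
  are required only eventually, since nothing is known for the indices below 2.\<close>

lemma weak_conv_m_return_if_mean_square:
  fixes Y :: "nat \<Rightarrow> 'a \<Rightarrow> real"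
  assumes prob: "eventually (\<lambda>n. prob_space (M n)) sequentially"
    and meas: "eventually (\<lambda>n. Y n \<in> borel_measurable (M n)) sequentially"
    and int: "eventually (\<lambda>n. integrable (M n) (\<lambda>\<omega>. (Y n \<omega> - c)\<^sup>2)) sequentially"
    and lim: "(\<lambda>n. integral\<^sup>L (M n) (\<lambda>\<omega>. (Y n \<omega> - c)\<^sup>2)) \<longlonglongrightarrow> 0"
  shows "weak_conv_m (\<lambda>n. distr (M n) borel (Y n)) (return borel c)"
  unfolding weak_conv_m_def weak_conv_def
proof (intro allI impI)
  fix x assume cont: "isCont (cdf (return borel c)) x"
  interpret R: real_distribution "return borel c"
    by (simp add: real_distribution_def real_distribution_axioms_def prob_space_return)
  \<comment> \<open>The limit distribution function jumps at c, so c is not a continuity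
    point.\<close>
  have "x \<noteq> c"
    using cont by (auto simp: R.isCont_cdf measure_return)
  define V where "V n = integral\<^sup>L (M n) (\<lambda>\<omega>. (Y n \<omega> - c)\<^sup>2)" for n
  have "eventually (\<lambda>n. \<bar>cdf (distr (M n) borel (Y n)) x - cdf (return borel c) x\<bar>
      \<le> V n / (x - c)\<^sup>2) sequentially"
    using prob meas int
  proof eventually_elim
    case (elim n)
    interpret prob_space "M n" by fact
    have cdf: "cdf (distr (M n) borel (Y n)) x = prob {\<omega> \<in> space (M n). Y n \<omega> \<le> x}"
      using elim by (simp add: cdf_def measure_distr vimage_def Int_def conj_commute)
    have markov: "prob {\<omega> \<in> space (M n). (x - c)\<^sup>2 \<le> (Y n \<omega> - c)\<^sup>2} \<le> V n / (x - c)\<^sup>2"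
      unfolding V_def
      using elim \<open>x \<noteq> c\<close> by (intro integral_Markov_inequality_measure[where A = "{}"]) auto
    have [measurable]: "Y n \<in> borel_measurable (M n)" by fact
    show ?case
    proof (cases "x < c")
      case True
      \<comment> \<open>Left of c the limit value is 0, and Y \<le> x < c forces a deviation of at
        least c - x.\<close>
      have "prob {\<omega> \<in> space (M n). Y n \<omega> \<le> x} \<le> prob {\<omega> \<in> space (M n). (x - c)\<^sup>2 \<le> (Y n \<omega> - c)\<^sup>2}"
        using True by (intro finite_measure_mono) (auto simp flip: abs_le_square_iff)
      then show ?thesis
        using True order_trans[OF _ markov] by (simp add: cdf cdf_def[of "return borel c"] measure_return)
    next
      case False
      \<comment> \<open>Right of c the limit value is 1, so the error is the probability of the
        complement, where Y > x > c.\<close>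
      have "1 - prob {\<omega> \<in> space (M n). Y n \<omega> \<le> x} = prob {\<omega> \<in> space (M n). \<not> Y n \<omega> \<le> x}"
        by (subst prob_neg) auto
      also have "\<dots> \<le> prob {\<omega> \<in> space (M n). (x - c)\<^sup>2 \<le> (Y n \<omega> - c)\<^sup>2}"
        using False by (intro finite_measure_mono) (auto simp flip: abs_le_square_iff)
      finally show ?thesis
        using False \<open>x \<noteq> c\<close> order_trans[OF _ markov] by (simp add: cdf cdf_def[of "return borel c"] measure_return)
    qed
  qed
  moreover have "(\<lambda>n. V n / (x - c)\<^sup>2) \<longlonglongrightarrow> 0"
    using tendsto_divide[OF lim tendsto_const, of "(x - c)\<^sup>2"] \<open>x \<noteq> c\<close> by (simp add: V_def)
  ultimately have "(\<lambda>n. cdf (distr (M n) borel (Y n)) x - cdf (return borel c) x) \<longlonglongrightarrow> 0"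
    unfolding real_norm_def[symmetric] by (rule Lim_null_comparison)
  then show "(\<lambda>n. cdf (distr (M n) borel (Y n)) x) \<longlonglongrightarrow> cdf (return borel c) x"
    by (simp add: LIM_zero_iff)
qed

text \<open>The density delta(x - 1/8) is rendered as the point mass
  \<open>return borel (1 / 8)\<close>. Integrability is part of the claim so that the integral is a
  genuine mean.\<close>

theorem proposition4:
  fixes M :: "nat \<Rightarrow> 'a measure"
    and X :: "nat \<Rightarrow> 'a \<Rightarrow> nat"
  assumes "\<And>m. 2 \<le> m \<Longrightarrow> prob_space (M m)"
    and "\<And>m. 2 \<le> m \<Longrightarrow> X m \<in> measurable (M m) (count_space UNIV)"
    and "\<And>m n. 2 \<le> m \<Longrightarrow>
           measure (M m) {\<omega> \<in> space (M m). X m \<omega> = n} = real (num_ferrers m n) / (\<Sum>k. real (num_ferrers m k))"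
  shows "(\<forall>m\<ge>2. integrable (M m) (\<lambda>\<omega>. real (X m \<omega>)))
    \<and> (\<lambda>m. integral\<^sup>L (M m) (\<lambda>\<omega>. real (X m \<omega>))) \<sim>[sequentially] (\<lambda>m. (real m)\<^sup>2 / 8)
    \<and> weak_conv_m (\<lambda>m. distr (M m) borel (\<lambda>\<omega>. real (X m \<omega>) / (real m)\<^sup>2)) (return borel (1 / 8))"
proof (intro conjI allI impI)
  have expectation: "integrable (M m) (\<lambda>\<omega>. g (X m \<omega>))"
    "integral\<^sup>L (M m) (\<lambda>\<omega>. g (X m \<omega>)) = (\<Sum>xs\<in>partitions m. g (area xs)) / card (partitions m)"
    if "2 \<le> m" for m and g :: "nat \<Rightarrow> real"
    using expectation_area[OF that assms[OF that]] by blast+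
  have ev: "eventually (\<lambda>m::nat. 2 \<le> m) sequentially" by (rule eventually_ge_at_top)
  show "integrable (M m) (\<lambda>\<omega>. real (X m \<omega>))" if "2 \<le> m" for m
    using that by (rule expectation(1))
  have mean: "integral\<^sup>L (M m) (\<lambda>\<omega>. real (X m \<omega>)) = (real m ^ 2 + 3 * m - 2) / 8" if "2 \<le> m" for m
    using that mean_area[OF that] expectation(2)[OF that, of real] by (simp add: mean_partitions_def)
  have "(\<lambda>m. (real m ^ 2 + 3 * real m - 2) / 8) \<sim>[sequentially] (\<lambda>m. (real m)\<^sup>2 / 8)"
    by real_asymp
  moreover have "eventually (\<lambda>m. (real m ^ 2 + 3 * real m - 2) / 8 =
      integral\<^sup>L (M m) (\<lambda>\<omega>. real (X m \<omega>))) sequentially"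
    using ev by eventually_elim (simp add: mean)
  ultimately show "(\<lambda>m. integral\<^sup>L (M m) (\<lambda>\<omega>. real (X m \<omega>))) \<sim>[sequentially] (\<lambda>m. (real m)\<^sup>2 / 8)"
    by (rule asymp_equiv_transfer[OF _ _ always_eventually]) auto
  show "weak_conv_m (\<lambda>m. distr (M m) borel (\<lambda>\<omega>. real (X m \<omega>) / (real m)\<^sup>2)) (return borel (1 / 8))"
  proof (rule weak_conv_m_return_if_mean_square)
    show "eventually (\<lambda>m. prob_space (M m)) sequentially"
      using ev by eventually_elim (rule assms)
    show "eventually (\<lambda>m. (\<lambda>\<omega>. real (X m \<omega>) / (real m)\<^sup>2) \<in> borel_measurable (M m)) sequentially"
      using ev
    proof eventually_elim
      case (elim m)
      note [measurable] = assms(2)[OF elim]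
      show ?case by measurable
    qed
    show "eventually (\<lambda>m. integrable (M m) (\<lambda>\<omega>. (real (X m \<omega>) / (real m)\<^sup>2 - 1 / 8)\<^sup>2)) sequentially"
      using ev
    proof eventually_elim
      case (elim m)
      then show ?case by (rule expectation(1))
    qed
    \<comment> \<open>The leading term of the mean-square deviation is 1 / (48 m).\<close>
    have "(\<lambda>m. (4 * real m ^ 3 + 9 * real m ^ 2 - 22 * real m + 24) / (192 * real m ^ 4)) \<longlonglongrightarrow> 0"
      by real_asymp
    moreover have "eventually (\<lambda>m. (4 * real m ^ 3 + 9 * real m ^ 2 - 22 * real m + 24) / (192 * real m ^ 4) =
        integral\<^sup>L (M m) (\<lambda>\<omega>. (real (X m \<omega>) / (real m)\<^sup>2 - 1 / 8)\<^sup>2)) sequentially"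
      using ev
    proof eventually_elim
      case (elim m)
      then show ?case
        using mean_area_deviation[OF elim]
          expectation(2)[OF elim, of "\<lambda>k. (real k / (real m)\<^sup>2 - 1 / 8)\<^sup>2"]
        by (simp add: mean_partitions_def)
    qed
    ultimately show "(\<lambda>m. integral\<^sup>L (M m) (\<lambda>\<omega>. (real (X m \<omega>) / (real m)\<^sup>2 - 1 / 8)\<^sup>2)) \<longlonglongrightarrow> 0"
      by (rule Lim_transform_eventually)
  qed
qed

end
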